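(* If $f\in\mathcal{S}^*_{C}$, then $f\in\Omega$ in the disc $|z|<r_0$, i.e. $|zf'(z)-f(z)|<\frac12$ for all $|z|<r_0$, where $r_0\approx0.411914$ is the positive root of $$2r\,e^{\frac{r^2}{3}+\frac{4r}{3}}\left(\frac{2r^2}{3}+\frac{4r}{3}\right)-1=0.$$
   Context: $\mathbb{D}=\{z\in\mathbb{C}:|z|<1\}$. $\mathcal{A}$ is the class of analytic functions $f$ on $\mathbb{D}$ with $f(0)=0$, $f'(0)=1$. $\Omega=\{f\in\mathcal{A}:|zf'(z)-f(z)|<\frac12,\ z\in\mathbb{D}\}$; "$f\in\Omega$ in the disc $|z|<r_0$" means that the defining inequality holds for all $|z|<r_0$. $\mathcal{S}^*_{C}$ is the class of $f\in\mathcal{A}$ with $zf'(z)/f(z)\prec 1+4z/3+2z^2/3$, where $p\prec\phi$ means $p=\phi\circ\omega$ for some analytic $\omega:\mathbb{D}\to\mathbb{D}$ with $\omega(0)=0$. *)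

theory Defs
  imports "HOL-Complex_Analysis.Complex_Analysis"
begin

abbreviation unit_disc :: "complex set" where
  "unit_disc \<equiv> ball 0 1"

definition class_A :: "(complex \<Rightarrow> complex) set" where
  "class_A = {f. f holomorphic_on unit_disc \<and> f 0 = 0 \<and> deriv f 0 = 1}"

definition subordinate :: "(complex \<Rightarrow> complex) \<Rightarrow> (complex \<Rightarrow> complex) \<Rightarrow> bool" where
  "subordinate p \<phi> \<longleftrightarrow>
     (\<exists>\<omega>. \<omega> holomorphic_on unit_disc \<and> \<omega> ` unit_disc \<subseteq> unit_disc \<and> \<omega> 0 = 0 \<and>
          (\<forall>z\<in>unit_disc. p z = \<phi> (\<omega> z)))"

(* The quotient z f'(z) / f(z) has a removable singularity at 0 for f in class_A,
   with limit f'(0) = 1; the value there is the analytic continuation. *)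
definition log_deriv_quot :: "(complex \<Rightarrow> complex) \<Rightarrow> complex \<Rightarrow> complex" where
  "log_deriv_quot f z = (if z = 0 then 1 else z * deriv f z / f z)"

(* Being of the form \<phi> o \<omega>, the quotient must be defined (and analytic) on the whole disc,
   so f has no zero other than 0; this is explicit because x / 0 = 0 in HOL. *)
definition class_S_C :: "(complex \<Rightarrow> complex) set" where
  "class_S_C = {f \<in> class_A. (\<forall>z\<in>unit_disc - {0}. f z \<noteq> 0) \<and>
     subordinate (log_deriv_quot f) (\<lambda>w. 1 + 4 * w / 3 + 2 * w\<^sup>2 / 3)}"

(* The functions satisfying the defining inequality of \<Omega> in |z| < r, meant for 0 < r \<le> 1;
   \<Omega> itself is the case r = 1. *)
definition Omega_in_disc :: "real \<Rightarrow> (complex \<Rightarrow> complex) set" where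
  "Omega_in_disc r = {f \<in> class_A. \<forall>z. norm z < r \<longrightarrow> norm (z * deriv f z - f z) < 1 / 2}"

end

theory Submission
  imports Defs
begin

text \<open>
  Write \<open>f z = z * exp (g z)\<close> with \<open>g\<close> holomorphic, so that
  \<open>z f'(z) / f(z) - 1 = z g'(z)\<close>. Subordination and the Schwarz lemma bound this
  by \<open>4r/3 + 2r\<^sup>2/3\<close> on \<open>|z| \<le> r\<close>; dividing by \<open>r\<close> and integrating along the
  radius gives \<open>|g z| \<le> 4r/3 + r\<^sup>2/3\<close>. Multiplying the resulting bound for
  \<open>|f z|\<close> by the one for \<open>|z f'(z) / f(z) - 1|\<close> yields half of an
  increasing function of \<open>r\<close>, which takes the value \<open>1\<close> exactly at \<open>r\<^sub>0\<close>.
\<close>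

text \<open>The quotient \<open>f z / z\<close>, filled in by \<open>deriv f 0 = 1\<close> at the
  origin, is holomorphic and zero-free on the disc, which is contractible, so it has a holomorphic
  logarithm. Subtracting the constant \<open>g 0\<close>, whose exponential is 1, normalizes
  it.\<close>

lemma class_A_log:
  assumes "f \<in> class_A" and nz: "\<And>z. z \<in> unit_disc - {0} \<Longrightarrow> f z \<noteq> 0"
  obtains g where "g holomorphic_on unit_disc" "g 0 = 0"
    "\<And>z. z \<in> unit_disc \<Longrightarrow> f z = z * exp (g z)"
proof -
  have hol: "f holomorphic_on unit_disc" and f0: "f 0 = 0" and d0: "deriv f 0 = 1"
    using assms(1) by (auto simp: class_A_def)
  define h where "h = (\<lambda>z. if z = 0 then deriv f 0 else (f z - f 0) / (z - 0))"
  have hh: "h holomorphic_on unit_disc"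
    unfolding h_def by (rule pole_theorem_open_0[OF hol, where a=0]) (auto simp: f0)
  have fh: "f z = z * h z" for z
    by (simp add: h_def f0)
  have h0: "h 0 = 1" and hnz: "\<And>z. z \<in> unit_disc \<Longrightarrow> h z \<noteq> 0"
    using nz d0 f0 by (auto simp: h_def)
  obtain g where g: "g holomorphic_on unit_disc" "\<And>z. z \<in> unit_disc \<Longrightarrow> h z = exp (g z)"
    by (rule contractible_imp_holomorphic_log[OF hh convex_imp_contractible[OF convex_ball] hnz])
      blast+
  show thesis
  proof
    show "(\<lambda>z. g z - g 0) holomorphic_on unit_disc"
      using g(1) by (intro holomorphic_intros)
    show "f z = z * exp (g z - g 0)" if "z \<in> unit_disc" for z
      using g(2)[OF that] g(2)[of 0] h0 fh[of z] by (simp add: exp_diff)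
  qed simp
qed

lemma class_S_C_growth:
  assumes f: "f \<in> class_S_C" and z: "norm z < 1"
  shows "norm (f z) \<le> norm z * exp ((norm z)\<^sup>2 / 3 + 4 * norm z / 3)"
    and "norm (z * deriv f z - f z) \<le> norm (f z) * (2 * (norm z)\<^sup>2 / 3 + 4 * norm z / 3)"
proof -
  have fA: "f \<in> class_A" and nz: "\<And>z. z \<in> unit_disc - {0} \<Longrightarrow> f z \<noteq> 0"
    using f by (auto simp: class_S_C_def)
  obtain \<omega> where \<omega>: "\<omega> holomorphic_on unit_disc" "\<omega> ` unit_disc \<subseteq> unit_disc" "\<omega> 0 = 0"
    and sub: "\<And>z. z \<in> unit_disc \<Longrightarrow>
        log_deriv_quot f z = 1 + 4 * \<omega> z / 3 + 2 * (\<omega> z)\<^sup>2 / 3"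
    using f by (auto simp: class_S_C_def subordinate_def)
  have schwarz: "norm (\<omega> u) \<le> norm u" if "norm u < 1" for u
    using \<omega>(2) that by (intro Schwarz_Lemma(1)[OF \<omega>(1,3)]) (auto simp: image_subset_iff)
  have quot: "norm (log_deriv_quot f u - 1) \<le> 2 * (norm u)\<^sup>2 / 3 + 4 * norm u / 3"
    if u: "norm u < 1" for u
  proof -
    have "norm (4 * \<omega> u / 3 + 2 * (\<omega> u)\<^sup>2 / 3) \<le> 4 * norm (\<omega> u) / 3 + 2 * (norm (\<omega> u))\<^sup>2 / 3"
      by (rule order_trans[OF norm_triangle_ineq]) (simp add: norm_mult norm_divide norm_power)
    also have "\<dots> \<le> 4 * norm u / 3 + 2 * (norm u)\<^sup>2 / 3"
      using schwarz[OF u]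
      by (intro add_mono divide_right_mono mult_left_mono power_mono) auto
    finally show ?thesis
      using sub[of u] u by (simp add: add_ac)
  qed
  have f0: "f 0 = 0"
    using fA by (simp add: class_A_def)
  show "norm (z * deriv f z - f z) \<le> norm (f z) * (2 * (norm z)\<^sup>2 / 3 + 4 * norm z / 3)"
  proof (cases "z = 0")
    case False
    then have "z * deriv f z - f z = f z * (log_deriv_quot f z - 1)"
      using nz[of z] z by (simp add: log_deriv_quot_def field_simps)
    then show ?thesis
      using quot[OF z] by (simp add: norm_mult mult_left_mono)
  qed (simp add: f0)
  obtain g where g: "g holomorphic_on unit_disc" "g 0 = 0"
    and fg: "\<And>z. z \<in> unit_disc \<Longrightarrow> f z = z * exp (g z)"
    using class_A_log[OF fA nz] by blast
  have dg: "(g has_field_derivative deriv g u) (at u)" if "norm u < 1" for u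
    using g(1) that by (intro holomorphic_derivI[of _ unit_disc]) auto
  have quot_g: "log_deriv_quot f u - 1 = u * deriv g u" if u: "norm u < 1" "u \<noteq> 0" for u
  proof -
    have "((\<lambda>z. z * exp (g z)) has_field_derivative exp (g u) + u * (exp (g u) * deriv g u)) (at u)"
      by (auto intro!: derivative_eq_intros dg u)
    then have "(f has_field_derivative exp (g u) + u * (exp (g u) * deriv g u)) (at u)"
      by (rule has_field_derivative_transform_within_open[where S=unit_disc]) (use u fg in auto)
    then show ?thesis
      using u fg[of u] by (simp add: DERIV_imp_deriv log_deriv_quot_def field_simps)
  qed
  \<comment> \<open>Mean value inequality along the segment from 0 to \<open>z\<close>. The
    derivative of the majorant is the bound \<open>quot\<close> at \<open>t * z\<close>, divided by
    \<open>t\<close>. The endpoints stay unsimplified to match the rule.\<close>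
  have "norm (g (complex_of_real 1 * z) - g (complex_of_real 0 * z))
      \<le> ((norm z)\<^sup>2 * 1\<^sup>2 / 3 + 4 * norm z * 1 / 3) - ((norm z)\<^sup>2 * 0\<^sup>2 / 3 + 4 * norm z * 0 / 3)"
  proof (rule differentiable_bound_general
      [where f = "\<lambda>t. g (of_real t * z)" and f' = "\<lambda>t. z * deriv g (of_real t * z)"
       and \<phi> = "\<lambda>t. (norm z)\<^sup>2 * t\<^sup>2 / 3 + 4 * norm z * t / 3"
       and \<phi>' = "\<lambda>t. 2 * (norm z)\<^sup>2 * t / 3 + 4 * norm z / 3"])
    have small: "norm (complex_of_real t * z) < 1" if "0 \<le> t" "t \<le> 1" for t
      using that z mult_right_mono[of t 1 "norm z"] by (simp add: norm_mult)
    show "continuous_on {0..1} (\<lambda>t. g (of_real t * z))"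
      by (intro continuous_on_compose2[OF holomorphic_on_imp_continuous_on[OF g(1)]]
            continuous_intros) (use small in auto)
    show "continuous_on {0..1} (\<lambda>t. (norm z)\<^sup>2 * t\<^sup>2 / 3 + 4 * norm z * t / 3)"
      by (intro continuous_intros) auto
    fix t :: real assume t: "0 < t" "t < 1"
    show "((\<lambda>t. g (of_real t * z)) has_vector_derivative z * deriv g (of_real t * z)) (at t)"
    proof -
      have "((\<lambda>t. of_real t * z) has_vector_derivative z) (at t)"
        by (auto intro!: derivative_eq_intros)
      from field_vector_diff_chain_at[OF this dg] show ?thesis
        using small[of t] t by (simp add: o_def)
    qed
    show "((\<lambda>t. (norm z)\<^sup>2 * t\<^sup>2 / 3 + 4 * norm z * t / 3) has_vector_derivative
        2 * (norm z)\<^sup>2 * t / 3 + 4 * norm z / 3) (at t)"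
      unfolding has_real_derivative_iff_has_vector_derivative[symmetric]
      by (auto intro!: derivative_eq_intros)
    show "norm (z * deriv g (of_real t * z)) \<le> 2 * (norm z)\<^sup>2 * t / 3 + 4 * norm z / 3"
    \<comment> \<open>For nonzero \<open>z\<close> the point \<open>t * z\<close> is nonzero, so
      \<open>quot_g\<close> applies there; both sides are multiplied by \<open>t > 0\<close>, which
      is cancelled at the end.\<close>
    proof (cases "z = 0")
      case False
      have "t * norm (z * deriv g (of_real t * z)) = norm (log_deriv_quot f (of_real t * z) - 1)"
        using quot_g[of "of_real t * z"] small[of t] t False by (simp add: norm_mult)
      also have "\<dots> \<le> t * (2 * (norm z)\<^sup>2 * t / 3 + 4 * norm z / 3)"
        using quot[OF small[of t]] t
        by (simp add: norm_mult power_mult_distrib algebra_simps power2_eq_square)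
      finally show ?thesis
        using t by simp
    qed simp
  qed simp
  \<comment> \<open>The real part suffices, since the modulus of \<open>exp (g z)\<close> is
    \<open>exp (Re (g z))\<close>.\<close>
  then have "Re (g z) \<le> (norm z)\<^sup>2 / 3 + 4 * norm z / 3"
    using g(2) complex_Re_le_cmod[of "g z"] by simp
  then show "norm (f z) \<le> norm z * exp ((norm z)\<^sup>2 / 3 + 4 * norm z / 3)"
    using fg[of z] z by (simp add: norm_mult mult_left_mono)
qed

text \<open>Twice the product of the majorants in \<open>class_S_C_growth\<close>, so the level 1
  corresponds to the bound 1/2 that defines \<open>Omega_in_disc\<close>.\<close>

definition radius_fun :: "real \<Rightarrow> real" where
  "radius_fun r = 2 * r * exp (r\<^sup>2 / 3 + 4 * r / 3) * (2 * r\<^sup>2 / 3 + 4 * r / 3)"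

lemma radius_fun_strict_mono:
  assumes "0 \<le> r" "r < s"
  shows "radius_fun r < radius_fun s"
proof -
  have sq: "r\<^sup>2 < s\<^sup>2"
    using assms by (intro power_strict_mono) auto
  \<comment> \<open>Strictness is taken from the quadratic factor: it may vanish at
    \<open>r = 0\<close>, but the factor it is multiplied by at \<open>s\<close> is
    positive.\<close>
  have "2 * r * exp (r\<^sup>2 / 3 + 4 * r / 3) \<le> 2 * s * exp (s\<^sup>2 / 3 + 4 * s / 3)"
    using assms sq by (intro mult_mono) auto
  moreover have "2 * r\<^sup>2 / 3 + 4 * r / 3 < 2 * s\<^sup>2 / 3 + 4 * s / 3"
    using assms sq by simp
  moreover have "0 < 2 * s * exp (s\<^sup>2 / 3 + 4 * s / 3)" "0 \<le> 2 * r\<^sup>2 / 3 + 4 * r / 3"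
    using assms by auto
  ultimately show ?thesis
    unfolding radius_fun_def by (meson mult_right_mono mult_strict_left_mono order_le_less_trans)
qed

text \<open>The Lagrange remainder is \<open>exp t * x ^ n / fact n\<close> with \<open>t\<close> at
  most 1 in modulus, hence nonnegative and controlled by \<open>exp 1 \<le> 3\<close>.\<close>

lemma exp_Taylor_bounds:
  fixes x :: real
  assumes "0 \<le> x" "x \<le> 1"
  shows "(\<Sum>k<n. x ^ k / fact k) \<le> exp x"
    and "exp x \<le> (\<Sum>k<n. x ^ k / fact k) + 3 * x ^ n / fact n"
proof -
  obtain t where t: "\<bar>t\<bar> \<le> \<bar>x\<bar>" "exp x = (\<Sum>k<n. x ^ k / fact k) + exp t / fact n * x ^ n"
    using Maclaurin_exp_le by blast
  have "exp t \<le> exp 1"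
    using t assms by simp
  also have "\<dots> \<le> 3"
    by (rule exp_le)
  finally have "exp t / fact n * x ^ n \<le> 3 / fact n * x ^ n"
    using assms by (intro mult_right_mono divide_right_mono) auto
  with t show "exp x \<le> (\<Sum>k<n. x ^ k / fact k) + 3 * x ^ n / fact n"
    by simp
  from t assms show "(\<Sum>k<n. x ^ k / fact k) \<le> exp x"
    by simp
qed

text \<open>The test points here and in \<open>radius_fun_upper\<close> are 0.411914 minus and plus
  0.0000005, so a root strictly between them has the claimed accuracy.\<close>

lemma radius_fun_lower: "radius_fun 0.4119135 < 1"
proof -
  have "exp (0.4119135\<^sup>2 / 3 + 4 * 0.4119135 / 3 :: real) < 1.83268"
    by (rule le_less_trans[OF exp_Taylor_bounds(2)[where n = 10]])
      (simp_all add: power2_eq_square eval_nat_numeral fact_numeral)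
  then show ?thesis
    unfolding radius_fun_def by (simp add: power2_eq_square)
qed

lemma radius_fun_upper: "1 < radius_fun 0.4119145"
proof -
  have "1.832675 < exp (0.4119145\<^sup>2 / 3 + 4 * 0.4119145 / 3 :: real)"
    by (rule less_le_trans[OF _ exp_Taylor_bounds(1)[where n = 10]])
      (simp_all add: power2_eq_square eval_nat_numeral fact_numeral)
  then show ?thesis
    unfolding radius_fun_def by (simp add: power2_eq_square)
qed

theorem theorem2p21:
  shows "\<exists>r0::real.
    {r::real. r > 0 \<and> 2 * r * exp (r\<^sup>2 / 3 + 4 * r / 3) * (2 * r\<^sup>2 / 3 + 4 * r / 3) - 1 = 0} = {r0} \<and>
    \<bar>r0 - 0.411914\<bar> < 0.0000005 \<and>
    (\<forall>f \<in> class_S_C. f \<in> Omega_in_disc r0)"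
proof -
  have "continuous_on {0.4119135..0.4119145} radius_fun"
    unfolding radius_fun_def by (intro continuous_intros) auto
  then obtain r0 where r0: "0.4119135 \<le> r0" "r0 \<le> 0.4119145" "radius_fun r0 = 1"
    using IVT'[of radius_fun "0.4119135" 1 "0.4119145"] radius_fun_lower radius_fun_upper by auto
  \<comment> \<open>The intermediate value theorem only places \<open>r0\<close> in the closed
    interval; the endpoints are excluded because \<open>radius_fun\<close> differs from 1
    there.\<close>
  have r0_strict: "0.4119135 < r0" "r0 < 0.4119145"
    using r0 radius_fun_lower radius_fun_upper by (metis order_less_le)+
  have "r = r0" if "r > 0" "radius_fun r = 1" for r
    using that r0 radius_fun_strict_mono[of r r0] radius_fun_strict_mono[of r0 r]
    by (cases r r0 rule: linorder_cases) auto
  then have "{r. r > 0 \<and> radius_fun r - 1 = 0} = {r0}"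
    using r0 by auto
  moreover have "\<bar>r0 - 0.411914\<bar> < 0.0000005"
    using r0_strict unfolding abs_less_iff by simp
  moreover have "f \<in> Omega_in_disc r0" if f: "f \<in> class_S_C" for f
  proof -
    have "norm (z * deriv f z - f z) < 1 / 2" if z: "norm z < r0" for z
    proof -
      have z1: "norm z < 1"
        using z r0 by simp
      let ?q = "2 * (norm z)\<^sup>2 / 3 + 4 * norm z / 3"
      have "norm (z * deriv f z - f z) \<le> norm (f z) * ?q"
        by (rule class_S_C_growth(2)[OF f z1])
      also have "\<dots> \<le> norm z * exp ((norm z)\<^sup>2 / 3 + 4 * norm z / 3) * ?q"
        by (intro mult_right_mono class_S_C_growth(1)[OF f z1]) auto
      also have "\<dots> = radius_fun (norm z) / 2"
        by (simp add: radius_fun_def)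
      also have "\<dots> < 1 / 2"
        using radius_fun_strict_mono[of "norm z" r0] z r0 by simp
      finally show ?thesis .
    qed
    then show ?thesis
      using f by (simp add: Omega_in_disc_def class_S_C_def)
  qed
  ultimately show ?thesis
    unfolding radius_fun_def by blast
qed

end
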